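(* Consider the hard-cluster community model with parameters $(n,k,\tau)$, where $k=k_n$ and $\tau=\tau_n$ may depend on $n$ and asymptotics are as $n\to\infty$. (a) (Achievability) The community interval test with parameters $(k,\tau)$ (window length $2\pi\tau$, subset size $k$) satisfies $p_{\mathrm{miss}}=0$ and $$p_{\mathrm{fa}}\le\exp\left(\log\frac{\binom k2}{\tau}+k\left\{\log\frac nk+1+\frac{k-1}{2}\log\tau\right\}\right).$$ Thus strong detection is achieved if the right-hand side of this bound converges to zero. (b) (Converse) If $$\frac{k^2}{n}\left(\left(\frac1\tau\right)^{\frac{k-1}{2}}-1\right)\to0\qquad\text{as }n\to\infty,$$ then weak detection is impossible.
   Context: Hard-cluster community model $(n,k,\tau)$, with $2\le k\le n$ an integer and $\tau\in(0,1)$: a symmetric array of angles $X=(X_{ij})_{1\le i<j\le n}$, $X_{ij}=X_{ji}\in[0,2\pi)$, is observed, viewed as labels $X_e$ on the edges $e=\{i,j\}$ of the complete graph on $[n]$. For $C\subset[n]$, $E(C)$ is the set of edges with both endpoints in $C$. Under $H_0$ (law $\mathbb{Q}$) the $X_{ij}$, $i<j$, are i.i.d. uniform on $[0,2\pi)$. Under $H_1$ (law $\mathbb{P}$), a community $C^*\subset[n]$ is drawn uniformly at random among subsets of size $k$, a phase $\Theta^*$ is drawn independently and uniformly on $[0,2\pi)$, and given $(C^*,\Theta^* )$ the labels are independent with $X_e$ uniform on the arc $[\Theta^*,\Theta^*+2\pi\tau]$ (mod $2\pi$) for $e\in E(C^* )$ and $X_e$ uniform on $[0,2\pi)$ for all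 other edges. $\mathbb{P}$ is the resulting mixture law of $X$. All arcs are understood modulo $2\pi$. A test is a measurable function $\phi$ of the data with values in $\{0,1\}$ ($1$ means reject $H_0$). $p_{\mathrm{fa}}(\phi)=\mathbb{Q}\{\phi(X)=1\}$ and $p_{\mathrm{miss}}(\phi)=\mathbb{P}\{\phi(X)=0\}$. A sequence of tests achieves strong detection if both $p_{\mathrm{fa}}\to0$ and $p_{\mathrm{miss}}\to0$. Weak detection is impossible if every sequence of tests satisfies $p_{\mathrm{fa}}+p_{\mathrm{miss}}\ge 1-o(1)$; equivalently the total variation distance between $\mathbb{P}$ and $\mathbb{Q}$ tends to $0$. Community interval test with parameters $(k,\tau)$: reject $H_0$ if and only if there exist $\theta\in[0,2\pi)$ and $C\subset[n]$ with $|C|=k$ such that $X_e\in[\theta,\theta+2\pi\tau]$ for all $e\in E(C)$. $\log$ is the natural logarithm. *)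

theory Defs
  imports "HOL-Probability.Probability"
begin

definition angles :: "real measure" where
  "angles = restrict_space lborel {0..<2*pi}"

definition uniform_angle :: "real measure" where
  "uniform_angle = uniform_measure angles {0..<2*pi}"

text \<open>The closed arc \<open>[\<theta>, \<theta> + w]\<close> modulo \<open>2\<pi>\<close>, by its representatives in \<open>[0, 2\<pi>)\<close>.\<close>

definition angle_arc :: "real \<Rightarrow> real \<Rightarrow> real set" where
  "angle_arc \<theta> w = {x \<in> {0..<2*pi}. \<exists>m::int. x + 2*pi * of_int m \<in> {\<theta>..\<theta> + w}}"

text \<open>An edge is the unordered pair of its endpoints, so that a family of angles indexed by
  \<open>edges {1..n}\<close> is a symmetric array without diagonal.\<close>

definition edges :: "nat set \<Rightarrow> nat set set" where
  "edges C = {e. e \<subseteq> C \<and> card e = 2}"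

definition labellings :: "nat \<Rightarrow> (nat set \<Rightarrow> real) measure" where
  "labellings n = (\<Pi>\<^sub>M e\<in>edges {1..n}. angles)"

definition communities :: "nat \<Rightarrow> nat \<Rightarrow> nat set set" where
  "communities n k = {C. C \<subseteq> {1..n} \<and> card C = k}"

definition null_law :: "nat \<Rightarrow> (nat set \<Rightarrow> real) measure" where
  "null_law n = (\<Pi>\<^sub>M e\<in>edges {1..n}. uniform_angle)"

definition conditional_law ::
    "nat \<Rightarrow> real \<Rightarrow> nat set \<Rightarrow> real \<Rightarrow> (nat set \<Rightarrow> real) measure" where
  "conditional_law n \<tau> C \<theta> =
     (\<Pi>\<^sub>M e\<in>edges {1..n}.
        if e \<in> edges C then uniform_measure angles (angle_arc \<theta> (2*pi*\<tau>)) else uniform_angle)"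

definition planted_law :: "nat \<Rightarrow> nat \<Rightarrow> real \<Rightarrow> (nat set \<Rightarrow> real) measure" where
  "planted_law n k \<tau> =
     (uniform_count_measure (communities n k) \<Otimes>\<^sub>M uniform_angle) \<bind>
       (\<lambda>(C, \<theta>). conditional_law n \<tau> C \<theta>)"

definition tests :: "nat \<Rightarrow> ((nat set \<Rightarrow> real) \<Rightarrow> nat) set" where
  "tests n = labellings n \<rightarrow>\<^sub>M count_space {0, 1}"

definition p_fa :: "nat \<Rightarrow> ((nat set \<Rightarrow> real) \<Rightarrow> nat) \<Rightarrow> real" where
  "p_fa n \<phi> = measure (null_law n) {X \<in> space (null_law n). \<phi> X = 1}"

definition p_miss :: "nat \<Rightarrow> nat \<Rightarrow> real \<Rightarrow> ((nat set \<Rightarrow> real) \<Rightarrow> nat) \<Rightarrow> real" where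
  "p_miss n k \<tau> \<phi> =
     measure (planted_law n k \<tau>) {X \<in> space (planted_law n k \<tau>). \<phi> X = 0}"

definition community_interval_test ::
    "nat \<Rightarrow> nat \<Rightarrow> real \<Rightarrow> (nat set \<Rightarrow> real) \<Rightarrow> nat" where
  "community_interval_test n k \<tau> X =
     (if \<exists>\<theta>\<in>{0..<2*pi}. \<exists>C\<in>communities n k. \<forall>e\<in>edges C. X e \<in> angle_arc \<theta> (2*pi*\<tau>)
      then 1 else 0)"

text \<open>The model exists only for \<open>n \<ge> 2\<close>, because \<open>2 \<le> k \<le> n\<close>.\<close>

definition test_sequence :: "(nat \<Rightarrow> (nat set \<Rightarrow> real) \<Rightarrow> nat) \<Rightarrow> bool" where
  "test_sequence \<phi> \<longleftrightarrow> (\<forall>n\<ge>2. \<phi> n \<in> tests n)"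

definition achieves_strong_detection ::
    "(nat \<Rightarrow> nat) \<Rightarrow> (nat \<Rightarrow> real) \<Rightarrow> (nat \<Rightarrow> (nat set \<Rightarrow> real) \<Rightarrow> nat) \<Rightarrow> bool" where
  "achieves_strong_detection k \<tau> \<phi> \<longleftrightarrow> test_sequence \<phi> \<and>
     (\<lambda>n. p_fa n (\<phi> n)) \<longlonglongrightarrow> 0 \<and> (\<lambda>n. p_miss n (k n) (\<tau> n) (\<phi> n)) \<longlonglongrightarrow> 0"

definition weak_detection_impossible :: "(nat \<Rightarrow> nat) \<Rightarrow> (nat \<Rightarrow> real) \<Rightarrow> bool" where
  "weak_detection_impossible k \<tau> \<longleftrightarrow>
     (\<forall>\<phi>. test_sequence \<phi> \<longrightarrow>
        (\<exists>\<epsilon>::nat \<Rightarrow> real. \<epsilon> \<longlonglongrightarrow> 0 \<and>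
           (\<forall>n\<ge>2. p_fa n (\<phi> n) + p_miss n (k n) (\<tau> n) (\<phi> n) \<ge> 1 - \<epsilon> n)))"

definition fa_bound :: "nat \<Rightarrow> nat \<Rightarrow> real \<Rightarrow> real" where
  "fa_bound n k \<tau> =
     exp (ln (real (k choose 2) / \<tau>) +
          real k * (ln (real n / real k) + 1 + (real k - 1) / 2 * ln \<tau>))"

end

theory Submission
  imports Defs
begin

text \<open>
  The test never misses, since the planted community and phase satisfy its rejection condition. For
  false alarms, an arc containing all labels of a community can be rotated until it starts at one of
  those labels (\<open>some_arc_iff_arc_at_label\<close>). Under the null law the remaining labels
  then lie in the arc independently with probability \<open>\<tau>\<close> each, and the bound is a union
  bound over the community and the edge carrying the first label, with
  \<open>n choose k \<le> (exp 1 * n / k) ^ k\<close>.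

  For the converse, fix the phase \<open>\<theta>\<close>. Given the community \<open>C\<close>, the labels follow the null law
  conditioned on the event that all labels of \<open>edges C\<close> lie in the arc (\<open>conditional_law_eq\<close>). The
  mixture over \<open>C\<close> is thus a uniform average of conditioned measures, and its distance to the null
  law is controlled by the probabilities of pairwise intersections of the conditioning events
  (\<open>mixture_second_moment_bound\<close>). For communities sharing \<open>j\<close> vertices such an intersection is more
  likely than under independence by the factor \<open>(1 / \<tau>) ^ (j choose 2)\<close>, which is at most
  \<open>a ^ j\<close> with \<open>a = (1 / \<tau>) powr ((k - 1) / 2)\<close>. The overlap \<open>j\<close> is hypergeometric, and expanding
  \<open>a ^ j\<close> over subsets of the overlap bounds its mean by \<open>(1 + k / n * (a - 1)) ^ k \<le> exp (k\<^sup>2 / n * (a - 1))\<close>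
  (\<open>hypergeometric_power_mean_le\<close>). The hypothesis of the converse says that the exponent tends to 0.
  The bound is uniform in the phase, so it survives integration over the phase
  (\<open>error_sum_ge\<close>).
\<close>

section \<open>Binomial coefficients and the overlap of random subsets\<close>

lemma real_choose_two: "real (m choose 2) = real m * (real m - 1) / 2"
  by (cases m) (simp_all add: choose_two real_of_nat_div algebra_simps)

text \<open>For \<open>0 < n\<close>, after division by \<open>n ^ s * (n choose k)\<close> this bounds the probability that a uniform
  \<open>k\<close>-subset of \<open>n\<close> points contains \<open>s\<close> given points by \<open>(k/n) ^ s\<close>, its value for independent
  inclusions. The points can be added one at a time: given that \<open>s\<close> of them are contained, the next
  one is contained with probability \<open>(k - s)/(n - s) \<le> k/n\<close>.\<close>

lemma binomial_descend_le:
  assumes "k \<le> n" "s \<le> k"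
  shows "((n - s) choose (k - s)) * n ^ s \<le> k ^ s * (n choose k)"
  using assms(2)
proof (induction s)
  case (Suc s)
  define f where "f s = (n - s) choose (k - s)" for s
  have le: "s < k" "s < n" using Suc.prems assms by auto
  have step: "f (Suc s) * (n - s) = (k - s) * f s"
    using Suc_times_binomial[of "k - Suc s" "n - Suc s"] le by (simp add: f_def Suc_diff_Suc mult.commute)
  have "(k - s) * n \<le> k * (n - s)"
    using assms le by (simp add: algebra_simps diff_mult_distrib diff_mult_distrib2 diff_le_mono2 mult_le_mono)
  then have "f s * ((k - s) * n) \<le> f s * (k * (n - s))"
    by (rule mult_le_mono2)
  moreover have "f (Suc s) * n * (n - s) = f s * ((k - s) * n)"
    using step by (simp add: algebra_simps)
  ultimately have "f (Suc s) * n * (n - s) \<le> k * f s * (n - s)"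
    by (simp only: mult_ac)
  then have "f (Suc s) * n \<le> k * f s" using le by simp
  then have "f (Suc s) * n * n ^ s \<le> k * f s * n ^ s"
    by (rule mult_le_mono1)
  then have "f (Suc s) * n ^ Suc s \<le> k * (f s * n ^ s)"
    by (simp add: mult_ac)
  also have "\<dots> \<le> k * (k ^ s * (n choose k))"
    using Suc by (intro mult_le_mono2) (simp add: f_def)
  finally show ?case by (simp add: f_def mult_ac)
qed simp

lemma card_supersets_of_card:
  assumes "finite V" "S \<subseteq> V" "card S \<le> k"
  shows "card {C. S \<subseteq> C \<and> C \<subseteq> V \<and> card C = k} = (card V - card S) choose (k - card S)"
proof -
  have fin: "finite C" if "C \<subseteq> V" for C using assms that finite_subset by blast
  have "bij_betw (\<lambda>C. C - S) {C. S \<subseteq> C \<and> C \<subseteq> V \<and> card C = k} {B. B \<subseteq> V - S \<and> card B = k - card S}"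
  proof (rule bij_betw_byWitness[where f'="\<lambda>B. B \<union> S"])
    show "(\<lambda>B. B \<union> S) ` {B. B \<subseteq> V - S \<and> card B = k - card S} \<subseteq> {C. S \<subseteq> C \<and> C \<subseteq> V \<and> card C = k}"
    proof safe
      fix B assume B: "B \<subseteq> V - S" "card B = k - card S"
      then have "finite B" "B \<inter> S = {}" using fin by auto
      then show "card (B \<union> S) = k" using B assms fin by (simp add: card_Un_disjoint)
    qed (use assms in auto)
  qed (use fin assms in \<open>auto simp: card_Diff_subset\<close>)
  then have "card {C. S \<subseteq> C \<and> C \<subseteq> V \<and> card C = k} = card (V - S) choose (k - card S)"
    using n_subsets[of "V - S" "k - card S"] assms by (simp add: bij_betw_same_card)
  then show ?thesis using assms fin by (simp add: card_Diff_subset)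
qed

lemma power_card_eq_sum_Pow:
  fixes b :: real
  assumes "finite B"
  shows "(1 + b) ^ card B = (\<Sum>S\<in>Pow B. b ^ card S)"
  using prod_add[OF assms, of "\<lambda>_. b" "\<lambda>_. 1"] by (simp add: add.commute)

text \<open>The size of the overlap of a fixed and a uniform \<open>k\<close>-subset is hypergeometric, and its generating
  function at \<open>a \<ge> 1\<close> is at most that of a binomial variable with the same mean. Writing
  \<open>a ^ card B\<close> as the sum of \<open>(a - 1) ^ card S\<close> over \<open>S \<subseteq> B\<close> reduces this to the probabilities that the random
  subset contains \<open>S\<close>; the weights \<open>(a - 1) ^ card S\<close> are nonnegative, so upper bounds on these
  probabilities suffice.\<close>

lemma hypergeometric_power_mean_le:
  fixes a :: real
  assumes V: "finite V" and C: "C \<subseteq> V" "card C = k" and a: "1 \<le> a"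
  shows "(\<Sum>C' | C' \<subseteq> V \<and> card C' = k. a ^ card (C \<inter> C'))
    \<le> real (card V choose k) * (1 + real k / real (card V) * (a - 1)) ^ k"
proof -
  let ?n = "card V" and ?F = "{C'. C' \<subseteq> V \<and> card C' = k}"
  have fin: "finite C" "finite ?F" using V C finite_subset[of _ V] by auto
  have kn: "k \<le> ?n" using V C card_mono by blast
  have "a ^ card (C \<inter> C') = (\<Sum>S\<in>Pow C. if S \<subseteq> C' then (a - 1) ^ card S else 0)" for C'
  proof -
    have "Pow C \<inter> {S. S \<subseteq> C'} = Pow (C \<inter> C')" by auto
    then show ?thesis
      using power_card_eq_sum_Pow[of "C \<inter> C'" "a - 1"] fin by (simp add: sum.If_cases)
  qed
  then have "(\<Sum>C'\<in>?F. a ^ card (C \<inter> C')) = (\<Sum>S\<in>Pow C. \<Sum>C'\<in>?F. if S \<subseteq> C' then (a - 1) ^ card S else 0)"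
    using sum.swap by simp
  also have "\<dots> \<le> (\<Sum>S\<in>Pow C. real (?n choose k) * (real k / real ?n * (a - 1)) ^ card S)"
  proof (rule sum_mono)
    fix S assume "S \<in> Pow C"
    then have S: "S \<subseteq> V" "card S \<le> k" using C fin card_mono by auto
    have "?F \<inter> {C'. S \<subseteq> C'} = {C'. S \<subseteq> C' \<and> C' \<subseteq> V \<and> card C' = k}" by auto
    then have "(\<Sum>C'\<in>?F. if S \<subseteq> C' then (a - 1) ^ card S else 0)
        = real ((?n - card S) choose (k - card S)) * (a - 1) ^ card S"
      using card_supersets_of_card[OF V S] fin by (simp add: sum.If_cases)
    moreover have "real ((?n - card S) choose (k - card S)) \<le> real (?n choose k) * (real k / real ?n) ^ card S"
    proof (cases "?n = 0")
      case True
      then show ?thesis using S kn by simp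
    next
      case False
      have "real (((?n - card S) choose (k - card S)) * ?n ^ card S) \<le> real (k ^ card S * (?n choose k))"
        using binomial_descend_le[OF kn S(2)] by (simp only: of_nat_le_iff)
      then show ?thesis using False by (simp add: field_simps power_divide)
    qed
    ultimately have "(\<Sum>C'\<in>?F. if S \<subseteq> C' then (a - 1) ^ card S else 0)
        \<le> (real (?n choose k) * (real k / real ?n) ^ card S) * (a - 1) ^ card S"
      using a by (simp only:) (intro mult_right_mono, auto)
    then show "(\<Sum>C'\<in>?F. if S \<subseteq> C' then (a - 1) ^ card S else 0)
        \<le> real (?n choose k) * (real k / real ?n * (a - 1)) ^ card S"
      by (simp only: power_mult_distrib mult.assoc)
  qed
  also have "\<dots> = real (?n choose k) * (1 + real k / real ?n * (a - 1)) ^ k"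
    using power_card_eq_sum_Pow[OF fin(1)] C by (simp add: sum_distrib_left)
  finally show ?thesis .
qed

text \<open>A single term of the exponential series gives \<open>k ^ k / fact k \<le> exp k\<close>.\<close>

lemma binomial_le_exp_power:
  assumes "0 < k"
  shows "real (n choose k) \<le> (exp 1 * real n / real k) ^ k"
proof -
  have "real k ^ k / fact k \<le> exp (real k)"
  proof -
    have s: "(\<lambda>i. real k ^ i /\<^sub>R fact i) sums exp (real k)" by (rule exp_converges)
    have "(\<Sum>i\<in>{k}. real k ^ i /\<^sub>R fact i) \<le> (\<Sum>i. real k ^ i /\<^sub>R fact i)"
      by (rule sum_le_suminf) (use s in \<open>auto simp: sums_iff\<close>)
    then show ?thesis using s by (simp add: sums_iff divide_inverse mult.commute)
  qed
  then have k: "real k ^ k \<le> exp (real k) * fact k" by (simp add: field_simps)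
  have "real ((n choose k) * fact k) \<le> real (n ^ k)"
    using binomial_fact_pow by (simp only: of_nat_le_iff)
  then have "real (n choose k) * fact k * real k ^ k \<le> real n ^ k * (exp (real k) * fact k)"
    using k by (intro mult_mono) auto
  then have "(real (n choose k) * real k ^ k) * fact k \<le> (real n ^ k * exp (real k)) * fact k"
    by (simp only: mult_ac)
  then have "real (n choose k) * real k ^ k \<le> real n ^ k * exp (real k)"
    using mult_le_cancel_right_pos[of "fact k :: real"] by simp
  then have "real (n choose k) \<le> exp (real k) * real n ^ k / real k ^ k"
    using assms by (simp add: field_simps)
  also have "exp (real k) = exp 1 ^ k"
    using exp_of_nat_mult[of k "1::real"] by simp
  finally show ?thesis
    by (simp add: power_divide power_mult_distrib)
qed

section \<open>Mixtures of conditioned measures\<close>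

text \<open>The conditioned measures \<open>A \<mapsto> prob (A \<inter> D c) / p\<close>, averaged over \<open>c \<in> S\<close>, form a measure with
  density \<open>L\<close>, the normalised number of events \<open>D c\<close> that occur. Its mean is 1, and the overlap sum is
  its second moment, so \<open>v\<close> bounds the variance of \<open>L\<close> (the chi-squared divergence). The difference of
  the two measures on \<open>A\<close> is the mean of \<open>(1 - L)\<close> over \<open>A\<close>, at most the square root of that variance.\<close>

lemma (in prob_space) mixture_second_moment_bound:
  assumes S: "finite S" "S \<noteq> {}" and D: "\<And>c. c \<in> S \<Longrightarrow> D c \<in> events"
    and p: "0 < p" "\<And>c. c \<in> S \<Longrightarrow> prob (D c) = p"
    and overlap: "(\<Sum>c\<in>S. \<Sum>c'\<in>S. prob (D c \<inter> D c')) / (real (card S) * p)\<^sup>2 \<le> 1 + v"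
    and A: "A \<in> events"
  shows "prob A - sqrt v \<le> (\<Sum>c\<in>S. prob (A \<inter> D c)) / (real (card S) * p)"
proof -
  define q where "q = real (card S) * p"
  have q: "0 < q" using S p by (simp add: q_def card_gt_0_iff)
  define L where "L x = (\<Sum>c\<in>S. indicator (D c) x) / q" for x
  define Y where "Y x = indicator A x * (1 - L x)" for x
  have [measurable]: "L \<in> borel_measurable M" "Y \<in> borel_measurable M"
    using D A by (auto simp: L_def[abs_def] Y_def[abs_def])
  have L_bd: "0 \<le> L x" "L x \<le> card S / q" for x
    using q by (auto simp: L_def intro!: divide_nonneg_pos sum_nonneg divide_right_mono
        order_trans[OF sum_bounded_above[where K=1]] split: split_indicator)
  have int_L: "integrable M L"
    by (rule integrable_const_bound[where B="card S / q"]) (use L_bd in auto)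
  have int_L2: "integrable M (\<lambda>x. (L x)\<^sup>2)"
    by (rule integrable_const_bound[where B="(card S / q)\<^sup>2"]) (use L_bd in \<open>auto intro: power_mono\<close>)
  have Y_abs: "\<bar>Y x\<bar> \<le> 1 + card S / q" for x
    using L_bd[of x] by (auto simp: Y_def split: split_indicator)
  have int_Y: "integrable M Y"
    by (rule integrable_const_bound[where B="1 + card S / q"]) (use Y_abs in auto)
  have Y2_le: "(Y x)\<^sup>2 \<le> (1 + card S / q)\<^sup>2" for x
    using power_mono[OF Y_abs abs_ge_zero, of x 2] by simp
  have int_Y2: "integrable M (\<lambda>x. (Y x)\<^sup>2)"
    by (rule integrable_const_bound[where B="(1 + card S / q)\<^sup>2"]) (use Y2_le in auto)
  have Y2_le_L: "(Y x)\<^sup>2 \<le> (L x)\<^sup>2 - 2 * L x + 1" for x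
    using zero_le_power2[of "1 - L x"]
    by (auto simp: Y_def power2_diff power_mult_distrib split: split_indicator)
  have EL: "expectation L = 1"
  proof -
    have "expectation L = (\<Sum>c\<in>S. expectation (indicator (D c))) / q"
      using D by (simp add: L_def[abs_def] Bochner_Integration.integral_sum integrable_real_indicator emeasure_eq_measure)
    also have "\<dots> = 1" using D p q S by (simp add: q_def)
    finally show ?thesis .
  qed
  have EL2: "expectation (\<lambda>x. (L x)\<^sup>2) \<le> 1 + v"
  proof -
    have "(L x)\<^sup>2 = (\<Sum>c\<in>S. \<Sum>c'\<in>S. indicator (D c \<inter> D c') x) / q\<^sup>2" for x
      by (simp add: L_def power2_eq_square sum_product indicator_inter_arith)
    then have "expectation (\<lambda>x. (L x)\<^sup>2) = (\<Sum>c\<in>S. \<Sum>c'\<in>S. expectation (indicator (D c \<inter> D c'))) / q\<^sup>2"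
      using D by (simp add: Bochner_Integration.integral_sum integrable_real_indicator emeasure_eq_measure)
    also have "\<dots> = (\<Sum>c\<in>S. \<Sum>c'\<in>S. prob (D c \<inter> D c')) / q\<^sup>2"
      using D by (intro arg_cong2[where f="(/)"] sum.cong refl) (simp add: sets.Int)
    finally show ?thesis using overlap by (simp add: q_def)
  qed
  \<comment> \<open>Jensen, in the form that variances are nonnegative.\<close>
  have "(expectation Y)\<^sup>2 \<le> expectation (\<lambda>x. (Y x)\<^sup>2)"
    using variance_positive[of Y] variance_eq[OF int_Y int_Y2] by simp
  also have "\<dots> \<le> expectation (\<lambda>x. (L x)\<^sup>2 - 2 * L x + 1)"
    by (rule integral_mono[OF int_Y2]) (use int_L int_L2 Y2_le_L in auto)
  also have "\<dots> = expectation (\<lambda>x. (L x)\<^sup>2) - 1"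
    using int_L int_L2 EL prob_space by simp
  also have "\<dots> \<le> v" using EL2 by simp
  finally have "expectation Y \<le> sqrt v"
    by (simp add: real_le_rsqrt)
  moreover have "expectation Y = prob A - (\<Sum>c\<in>S. prob (A \<inter> D c)) / q"
  proof -
    have "Y x = indicator A x - (\<Sum>c\<in>S. indicator (A \<inter> D c) x) / q" for x
      by (simp add: Y_def L_def algebra_simps indicator_inter_arith sum_distrib_left)
    then have "expectation Y = expectation (\<lambda>x. indicator A x - (\<Sum>c\<in>S. indicator (A \<inter> D c) x) / q)"
      by presburger
    also have "\<dots> = prob A - (\<Sum>c\<in>S. prob (A \<inter> D c)) / q"
      using A D by (simp add: Bochner_Integration.integral_sum integrable_real_indicator emeasure_eq_measure sets.Int)
    finally show ?thesis .
  qed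
  ultimately show ?thesis by (simp add: q_def)
qed

lemma nn_integral_uniform_count_measure:
  assumes "finite S"
  shows "(\<integral>\<^sup>+c. f c \<partial>uniform_count_measure S) = (\<Sum>c\<in>S. ennreal (1 / card S) * f c)"
  unfolding uniform_count_measure_def using assms by (rule nn_integral_point_measure_finite)

text \<open>Both sides are product measures on boxes: intersecting a box with the conditioning event only
  shrinks the sides with index in \<open>F\<close>, and the normalising constant is the product of the factors
  \<open>emeasure (M i) (A i)\<close>.\<close>

lemma PiM_uniform_measure:
  assumes I: "finite I" "F \<subseteq> I" and M: "\<And>i. prob_space (M i)"
    and A: "\<And>i. i \<in> F \<Longrightarrow> A i \<in> sets (M i)" "\<And>i. i \<in> F \<Longrightarrow> emeasure (M i) (A i) \<noteq> 0"
  shows "(\<Pi>\<^sub>M i\<in>I. if i \<in> F then uniform_measure (M i) (A i) else M i)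
    = uniform_measure (PiM I M) {x \<in> space (PiM I M). \<forall>i\<in>F. x i \<in> A i}"
proof -
  let ?N = "\<lambda>i. if i \<in> F then uniform_measure (M i) (A i) else M i"
  let ?D = "{x \<in> space (PiM I M). \<forall>i\<in>F. x i \<in> A i}"
  have N: "prob_space (?N i)" for i
  proof (cases "i \<in> F")
    case True
    interpret prob_space "M i" by (rule M)
    show ?thesis using A True by (auto intro!: prob_space_uniform_measure)
  qed (use M in auto)
  interpret M: product_prob_space M I
    by (intro product_prob_space.intro product_sigma_finite.intro product_prob_space_axioms.intro M prob_space_imp_sigma_finite)
  interpret N: product_prob_space ?N I
    by (intro product_prob_space.intro product_sigma_finite.intro product_prob_space_axioms.intro N prob_space_imp_sigma_finite)
  interpret P: prob_space "PiM I M" by (rule prob_space_PiM) (rule M)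
  have fin: "finite F" using I finite_subset by blast
  have D: "?D \<in> sets (PiM I M)"
    using fin A(1) subsetD[OF I(2)] by measurable
  have D_prob: "emeasure (PiM I M) ?D = (\<Prod>i\<in>F. emeasure (M i) (A i))"
    by (rule M.emeasure_PiM_Collect) (use I fin A in auto)
  have "uniform_measure (PiM I M) ?D = PiM I ?N"
  proof (rule N.PiM_eqI[OF I(1)])
    show "sets (uniform_measure (PiM I M) ?D) = sets (PiM I ?N)"
      unfolding sets_uniform_measure by (rule sets_PiM_cong) auto
  next
    fix B assume B_N: "\<And>i. i \<in> I \<Longrightarrow> B i \<in> sets (?N i)"
    have B: "B i \<in> sets (M i)" if "i \<in> I" for i
      using B_N[OF that] by (cases "i \<in> F") simp_all
    define E where "E i = (if i \<in> F then A i \<inter> B i else B i)" for i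
    have E: "E i \<in> sets (M i)" if "i \<in> I" for i using that B A by (auto simp: E_def)
    have box: "?D \<inter> Pi\<^sub>E I B = Pi\<^sub>E I E"
    proof (intro set_eqI iffI)
      fix X assume "X \<in> ?D \<inter> Pi\<^sub>E I B"
      then show "X \<in> Pi\<^sub>E I E" by (auto simp: E_def PiE_iff)
    next
      fix X assume X: "X \<in> Pi\<^sub>E I E"
      have X_B: "X i \<in> B i" if "i \<in> I" for i
        using PiE_mem[OF X that] by (auto simp: E_def split: if_splits)
      have X_A: "X i \<in> A i" if "i \<in> F" for i
        using PiE_mem[OF X subsetD[OF I(2) that]] that by (simp add: E_def)
      have "X i \<in> space (M i)" if "i \<in> I" for i
        using X_B[OF that] sets.sets_into_space[OF B[OF that]] by auto
      then show "X \<in> ?D \<inter> Pi\<^sub>E I B"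
        using X X_A X_B by (simp add: space_PiM PiE_iff)
    qed
    have "emeasure (uniform_measure (PiM I M) ?D) (Pi\<^sub>E I B)
        = (\<Prod>i\<in>I. emeasure (M i) (E i)) / (\<Prod>i\<in>F. emeasure (M i) (A i))"
      using B E I D by (simp add: box D_prob M.emeasure_PiM sets_PiM_I_finite)
    also have "(\<Prod>i\<in>I. emeasure (M i) (E i)) = (\<Prod>i\<in>F. emeasure (M i) (E i)) * (\<Prod>i\<in>I-F. emeasure (M i) (E i))"
      using I by (metis mult.commute prod.subset_diff)
    also have "\<dots> / (\<Prod>i\<in>F. emeasure (M i) (A i)) = (\<Prod>i\<in>F. emeasure (?N i) (B i)) * (\<Prod>i\<in>I-F. emeasure (?N i) (B i))"
    proof -
      \<comment> \<open>All factors are finite, so the quotient of products is computed in the reals.\<close>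
      define a e where "a i = measure (M i) (A i)" and "e i = measure (M i) (E i)" for i
      have ae: "emeasure (M i) (A i) = ennreal (a i)" "emeasure (M i) (E i) = ennreal (e i)" for i
        using M prob_space.finite_measure finite_measure.emeasure_eq_measure by (auto simp: a_def e_def)
      have a_pos: "0 < a i" if "i \<in> F" for i
        using A(2)[OF that] ae(1)[of i] by (cases "a i = 0") (auto simp: a_def zero_less_measure_iff)
      have e_nn: "0 \<le> e i" for i by (simp add: e_def)
      have "(\<Prod>i\<in>F. emeasure (M i) (E i)) / (\<Prod>i\<in>F. emeasure (M i) (A i)) = ennreal (\<Prod>i\<in>F. e i / a i)"
        using a_pos e_nn
        by (simp add: ae prod_ennreal less_imp_le divide_ennreal prod_nonneg prod_pos prod_dividef)
      also have "\<dots> = (\<Prod>i\<in>F. ennreal (e i / a i))"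
        using a_pos e_nn by (simp add: prod_ennreal less_imp_le)
      also have "\<dots> = (\<Prod>i\<in>F. emeasure (?N i) (B i))"
      proof (rule prod.cong)
        fix i assume i: "i \<in> F"
        have "emeasure (?N i) (B i) = emeasure (M i) (E i) / emeasure (M i) (A i)"
          using i I A(1)[OF i] B[of i] by (auto simp: E_def)
        then show "ennreal (e i / a i) = emeasure (?N i) (B i)"
          using a_pos[OF i] e_nn by (simp add: ae divide_ennreal)
      qed simp
      finally have "(\<Prod>i\<in>F. emeasure (M i) (E i)) / (\<Prod>i\<in>F. emeasure (M i) (A i))
          = (\<Prod>i\<in>F. emeasure (?N i) (B i))" .
      moreover have "(\<Prod>i\<in>I-F. emeasure (M i) (E i)) = (\<Prod>i\<in>I-F. emeasure (?N i) (B i))"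
        by (rule prod.cong) (auto simp: E_def)
      ultimately show ?thesis
        by (metis (no_types, lifting) ennreal_times_divide mult.commute)
    qed
    also have "\<dots> = (\<Prod>i\<in>I. emeasure (?N i) (B i))"
      using I by (metis (lifting) mult.commute prod.subset_diff)
    finally show "emeasure (uniform_measure (PiM I M) ?D) (Pi\<^sub>E I B) = (\<Prod>i\<in>I. emeasure (?N i) (B i))" .
  qed
  then show ?thesis by simp
qed

section \<open>Arcs of the circle\<close>

lemma space_angles [simp]: "space angles = {0..<2*pi}"
  by (simp add: angles_def space_restrict_space)

lemma sets_uniform_angle [simp, measurable_cong]: "sets uniform_angle = sets angles"
  by (simp add: uniform_angle_def)

lemma space_uniform_angle [simp]: "space uniform_angle = {0..<2*pi}"
  by (simp add: uniform_angle_def)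

lemma sets_angles_iff: "B \<in> sets angles \<longleftrightarrow> B \<in> sets borel \<and> B \<subseteq> {0..<2*pi}"
  unfolding angles_def by (subst sets_restrict_space_iff) auto

lemma emeasure_angles: "B \<in> sets angles \<Longrightarrow> emeasure angles B = emeasure lborel B"
  unfolding angles_def by (rule emeasure_restrict_space) (auto simp: sets_restrict_space)

lemma emeasure_uniform_angle:
  assumes "B \<in> sets angles"
  shows "emeasure uniform_angle B = emeasure lborel B / ennreal (2*pi)"
proof -
  have full: "{0..<2*pi} \<in> sets angles" by (simp add: sets_angles_iff)
  have "{0..<2*pi} \<inter> B = B" using assms by (auto simp: sets_angles_iff)
  then show ?thesis
    using emeasure_uniform_measure[OF full assms] emeasure_angles[OF full] emeasure_angles[OF assms]
    by (simp add: uniform_angle_def)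
qed

lemma prob_space_uniform_angle: "prob_space uniform_angle"
  by (rule prob_spaceI) (simp add: emeasure_uniform_angle sets_angles_iff divide_ennreal)

interpretation uniform_angle: prob_space uniform_angle
  by (rule prob_space_uniform_angle)

lemma measurable_angles_borel: "(\<lambda>x. x) \<in> borel_measurable angles"
  unfolding angles_def by (rule measurable_restrict_space1) simp

lemma pred_angle_arc [measurable (raw)]:
  assumes "f \<in> N \<rightarrow>\<^sub>M angles" "g \<in> N \<rightarrow>\<^sub>M angles"
  shows "Measurable.pred N (\<lambda>x. g x \<in> angle_arc (f x) w)"
proof -
  have [measurable]: "f \<in> borel_measurable N" "g \<in> borel_measurable N"
    using measurable_compose[OF assms(1) measurable_angles_borel]
      measurable_compose[OF assms(2) measurable_angles_borel] by auto
  show ?thesis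
    unfolding angle_arc_def mem_Collect_eq atLeastAtMost_iff atLeastLessThan_iff by measurable
qed

text \<open>Both \<open>x\<close> and \<open>\<theta>\<close> lie in one period and the arc is shorter than a period, so only the shifts
  by 0 and 1 periods can occur.\<close>

lemma angle_arc_eq:
  assumes "\<theta> \<in> {0..<2*pi}" "w < 2*pi"
  shows "angle_arc \<theta> w = {x \<in> {0..<2*pi}. x \<in> {\<theta>..\<theta> + w} \<or> x + 2*pi \<in> {\<theta>..\<theta> + w}}"
proof (intro set_eqI iffI)
  fix x assume "x \<in> angle_arc \<theta> w"
  then obtain m :: int where x: "0 \<le> x" "x < 2*pi" and m: "\<theta> \<le> x + 2*pi * of_int m" "x + 2*pi * of_int m \<le> \<theta> + w"
    by (auto simp: angle_arc_def)
  have "2*pi * (-1) < 2*pi * of_int m" "2*pi * of_int m < 2*pi * 2"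
    using x m assms unfolding atLeastLessThan_iff by linarith+
  then have "-1 < real_of_int m" "real_of_int m < 2"
    using mult_less_cancel_left_pos[of "2*pi"] pi_gt_zero by (metis zero_less_mult_iff zero_less_numeral)+
  then have "m = 0 \<or> m = 1" by linarith
  then show "x \<in> {x \<in> {0..<2*pi}. x \<in> {\<theta>..\<theta> + w} \<or> x + 2*pi \<in> {\<theta>..\<theta> + w}}"
    using x m by auto
next
  fix x assume "x \<in> {x \<in> {0..<2*pi}. x \<in> {\<theta>..\<theta> + w} \<or> x + 2*pi \<in> {\<theta>..\<theta> + w}}"
  moreover have "x + 2*pi * of_int 0 = x" "x + 2*pi * of_int 1 = x + 2*pi" by auto
  ultimately show "x \<in> angle_arc \<theta> w" unfolding angle_arc_def by (metis (mono_tags, lifting) mem_Collect_eq)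
qed

lemma angle_arc_in_sets [simp]: "angle_arc \<theta> w \<in> sets angles"
  unfolding sets_angles_iff angle_arc_def by auto

text \<open>An arc that passes the angle 0 is represented by two intervals; they are disjoint because the
  arc does not go around the whole circle.\<close>

lemma emeasure_lborel_angle_arc:
  assumes "\<theta> \<in> {0..<2*pi}" "0 \<le> w" "w < 2*pi"
  shows "emeasure lborel (angle_arc \<theta> w) = ennreal w"
proof (cases "\<theta> + w < 2*pi")
  case True
  then have "angle_arc \<theta> w = {\<theta>..\<theta> + w}" using assms by (auto simp: angle_arc_eq)
  then show ?thesis using assms by simp
next
  case False
  then have eq: "angle_arc \<theta> w = {\<theta>..<2*pi} \<union> {0..\<theta> + w - 2*pi}"
    using assms by (auto simp: angle_arc_eq)
  have "{\<theta>..<2*pi} \<inter> {0..\<theta> + w - 2*pi} = {}" using assms by auto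
  then have "emeasure lborel (angle_arc \<theta> w) = ennreal (2*pi - \<theta>) + ennreal (\<theta> + w - 2*pi)"
    using assms False by (simp add: eq plus_emeasure[symmetric])
  also have "\<dots> = ennreal w" using assms False by (simp flip: ennreal_plus)
  finally show ?thesis .
qed

lemma measure_uniform_angle_arc:
  assumes "\<theta> \<in> {0..<2*pi}" "0 < \<tau>" "\<tau> < 1"
  shows "measure uniform_angle (angle_arc \<theta> (2*pi*\<tau>)) = \<tau>"
  using assms emeasure_uniform_angle[of "angle_arc \<theta> (2*pi*\<tau>)"] emeasure_lborel_angle_arc[of \<theta> "2*pi*\<tau>"]
  by (simp add: measure_def divide_ennreal)

text \<open>Conditioning does not see the normalisation, so the community labels can be regarded as null
  labels conditioned to lie in the arc.\<close>

lemma uniform_measure_uniform_angle: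
  assumes "A \<in> sets angles" "emeasure angles A \<noteq> 0"
  shows "uniform_measure uniform_angle A = uniform_measure angles A"
proof (rule measure_eqI)
  fix B assume "B \<in> sets (uniform_measure uniform_angle A)"
  then have B: "B \<in> sets angles" by simp
  have AB: "A \<inter> B \<in> sets angles" using assms B by simp
  have fin: "emeasure angles E \<noteq> \<infinity>" if "E \<in> sets angles" for E
  proof -
    have "emeasure lborel E \<le> emeasure lborel {0..<2*pi}"
      using that by (intro emeasure_mono) (auto simp: sets_angles_iff)
    then show ?thesis using that by (auto simp: emeasure_angles top_unique)
  qed
  obtain a b where ab: "emeasure angles A = ennreal a" "emeasure angles (A \<inter> B) = ennreal b" "0 \<le> a" "0 \<le> b"
    using fin[OF assms(1)] fin[OF AB] by (metis ennreal_cases infinity_ennreal_def)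
  have "a > 0" using ab assms(2) by (cases "a = 0") auto
  then show "emeasure (uniform_measure uniform_angle A) B = emeasure (uniform_measure angles A) B"
    using assms B AB ab by (simp add: emeasure_uniform_angle emeasure_angles[symmetric] divide_ennreal)
qed simp

text \<open>If some arc of length \<open>w\<close> contains finitely many angles, then so does the arc that starts at the
  first of them. This replaces the uncountable choice of \<open>\<theta>\<close> by a finite one: the interval test
  becomes measurable and its false alarms can be estimated by a union bound.\<close>

lemma some_arc_iff_arc_at_label:
  assumes F: "finite F" "F \<noteq> {}" and w: "0 \<le> w"
  shows "(\<exists>\<theta>\<in>{0..<2*pi}. \<forall>e\<in>F. X e \<in> angle_arc \<theta> w) \<longleftrightarrow> (\<exists>f\<in>F. \<forall>e\<in>F. X e \<in> angle_arc (X f) w)"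
proof
  assume "\<exists>\<theta>\<in>{0..<2*pi}. \<forall>e\<in>F. X e \<in> angle_arc \<theta> w"
  then obtain \<theta> where "\<forall>e\<in>F. X e \<in> angle_arc \<theta> w" by blast
  then have "\<forall>e\<in>F. X e \<in> {0..<2*pi} \<and> (\<exists>m::int. X e + 2*pi * of_int m \<in> {\<theta>..\<theta> + w})"
    by (simp add: angle_arc_def)
  then obtain m :: "'a \<Rightarrow> int" where m: "\<And>e. e \<in> F \<Longrightarrow> X e \<in> {0..<2*pi} \<and> X e + 2*pi * of_int (m e) \<in> {\<theta>..\<theta> + w}"
    by metis
  \<comment> \<open>Lifts of the angles to the real line inside one interval of length \<open>w\<close>; \<open>f\<close> is the leftmost one.\<close>
  define y where "y e = X e + 2*pi * of_int (m e)" for e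
  obtain f where f: "f \<in> F" "\<And>e. e \<in> F \<Longrightarrow> y f \<le> y e"
    using ex_min_if_finite[of "y ` F"] F by (metis (no_types, lifting) arg_min_least arg_min_if_finite(1))
  have "X e \<in> angle_arc (X f) w" if e: "e \<in> F" for e
  proof -
    have "X e + 2*pi * of_int (m e - m f) \<in> {X f..X f + w}"
      using f(2)[OF e] m[OF e] m[OF f(1)] by (auto simp: y_def algebra_simps)
    then show ?thesis unfolding angle_arc_def using m[OF e] by blast
  qed
  then show "\<exists>f\<in>F. \<forall>e\<in>F. X e \<in> angle_arc (X f) w" using f(1) by blast
next
  assume "\<exists>f\<in>F. \<forall>e\<in>F. X e \<in> angle_arc (X f) w"
  then obtain f where f: "f \<in> F" "\<forall>e\<in>F. X e \<in> angle_arc (X f) w" by blast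
  then have "X f \<in> {0..<2*pi}" by (auto simp: angle_arc_def)
  then show "\<exists>\<theta>\<in>{0..<2*pi}. \<forall>e\<in>F. X e \<in> angle_arc \<theta> w" using f by blast
qed

section \<open>Labels under the null law\<close>

lemma prob_space_null_law: "prob_space (null_law n)"
  unfolding null_law_def by (rule prob_space_PiM) (rule prob_space_uniform_angle)

lemma sets_null_law [simp, measurable_cong]: "sets (null_law n) = sets (labellings n)"
  unfolding null_law_def labellings_def by (intro sets_PiM_cong) auto

lemma space_null_law: "space (null_law n) = space (labellings n)"
  by (rule sets_eq_imp_space_eq) simp

lemma finite_edges: "finite C \<Longrightarrow> finite (edges C)"
  by (rule finite_subset[of _ "Pow C"]) (auto simp: edges_def)

lemma card_edges: "finite C \<Longrightarrow> card (edges C) = card C choose 2"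
  using n_subsets[of C 2] by (simp add: edges_def)

lemma edges_mono: "C \<subseteq> D \<Longrightarrow> edges C \<subseteq> edges D"
  by (auto simp: edges_def)

lemma edges_Int: "edges C \<inter> edges D = edges (C \<inter> D)"
  by (auto simp: edges_def)

lemma finite_communities: "finite (communities n k)"
  by (rule finite_subset[of _ "Pow {1..n}"]) (auto simp: communities_def)

lemma card_communities: "card (communities n k) = n choose k"
  using n_subsets[of "{1..n}" k] by (simp add: communities_def)

lemma communityD:
  assumes "C \<in> communities n k"
  shows "finite C" "C \<subseteq> {1..n}" "card C = k" "edges C \<subseteq> edges {1..n}" "finite (edges C)"
    "card (edges C) = k choose 2"
  using assms finite_subset[of C "{1..n}"]
  by (auto simp: communities_def card_edges finite_edges intro: subsetD[OF edges_mono])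

text \<open>The edges are an arbitrary set \<open>F\<close> rather than those of one community, so that the intersection of
  two such events is again of this form.\<close>

definition arc_event :: "nat \<Rightarrow> real \<Rightarrow> nat set set \<Rightarrow> real \<Rightarrow> (nat set \<Rightarrow> real) set" where
  "arc_event n \<tau> F \<theta> = {X \<in> space (labellings n). \<forall>e\<in>F. X e \<in> angle_arc \<theta> (2*pi*\<tau>)}"

lemma measurable_label [measurable (raw)]: "e \<in> edges {1..n} \<Longrightarrow> (\<lambda>X. X e) \<in> labellings n \<rightarrow>\<^sub>M angles"
  unfolding labellings_def by (rule measurable_component_singleton)

text \<open>Joint measurability in the phase and the labels, which makes the conditional laws a kernel.\<close>

lemma pred_arc_event_jointly:
  assumes "finite F" "F \<subseteq> edges {1..n}"
  shows "Measurable.pred (uniform_angle \<Otimes>\<^sub>M null_law n) (\<lambda>(\<theta>, X). \<forall>e\<in>F. X e \<in> angle_arc \<theta> (2*pi*\<tau>))"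
proof -
  have "(\<lambda>p. snd p e) \<in> uniform_angle \<Otimes>\<^sub>M null_law n \<rightarrow>\<^sub>M angles" if "e \<in> F" for e
    using that assms by (intro measurable_compose[OF measurable_snd]) (auto simp: measurable_label)
  moreover have "fst \<in> uniform_angle \<Otimes>\<^sub>M null_law n \<rightarrow>\<^sub>M angles" by measurable
  ultimately show ?thesis
    unfolding case_prod_beta by (intro pred_intros_finite(3) assms pred_angle_arc) auto
qed

lemma arc_event_in_sets [simp]:
  assumes "finite F" "F \<subseteq> edges {1..n}"
  shows "arc_event n \<tau> F \<theta> \<in> sets (labellings n)"
proof -
  have "{X \<in> space (labellings n). X e \<in> angle_arc \<theta> (2*pi*\<tau>)} \<in> sets (labellings n)" if "e \<in> F" for e
    using measurable_sets[OF measurable_label angle_arc_in_sets] that assms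
    by (auto simp: vimage_def Int_def conj_commute)
  then show ?thesis
    unfolding arc_event_def using assms by (intro sets.sets_Collect_finite_All) auto
qed

lemma prob_arc_event:
  assumes "finite F" "F \<subseteq> edges {1..n}" "\<theta> \<in> {0..<2*pi}" "0 < \<tau>" "\<tau> < 1"
  shows "measure (null_law n) (arc_event n \<tau> F \<theta>) = \<tau> ^ card F"
proof -
  interpret product_prob_space "\<lambda>_::nat set. uniform_angle" "edges {1..n}"
    by (intro product_prob_space.intro product_sigma_finite.intro product_prob_space_axioms.intro
        prob_space_imp_sigma_finite prob_space_uniform_angle)
  have "emeasure (null_law n) (arc_event n \<tau> F \<theta>) = (\<Prod>e\<in>F. emeasure uniform_angle (angle_arc \<theta> (2*pi*\<tau>)))"
    unfolding arc_event_def space_null_law[symmetric] unfolding null_law_def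
    by (rule emeasure_PiM_Collect) (use assms in auto)
  also have "\<dots> = ennreal (\<tau> ^ card F)"
    using assms by (simp add: uniform_angle.emeasure_eq_measure measure_uniform_angle_arc ennreal_power)
  finally show ?thesis using assms by (simp add: measure_def)
qed

text \<open>The conditioning event restricts each label separately, so it preserves the independence of the
  labels and changes only the marginals on \<open>edges C\<close>.\<close>

lemma conditional_law_eq:
  assumes "edges C \<subseteq> edges {1..n}" "\<theta> \<in> {0..<2*pi}" "0 < \<tau>" "\<tau> < 1"
  shows "conditional_law n \<tau> C \<theta> = uniform_measure (null_law n) (arc_event n \<tau> (edges C) \<theta>)"
proof -
  have nz: "emeasure angles (angle_arc \<theta> (2*pi*\<tau>)) \<noteq> 0" "emeasure uniform_angle (angle_arc \<theta> (2*pi*\<tau>)) \<noteq> 0"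
    using assms measure_uniform_angle_arc[OF assms(2-4)]
    by (auto simp: emeasure_angles emeasure_lborel_angle_arc uniform_angle.emeasure_eq_measure)
  show ?thesis
    unfolding conditional_law_def arc_event_def space_null_law[symmetric] unfolding null_law_def
    using nz assms finite_edges[of "{1..n}"]
    by (subst PiM_uniform_measure[symmetric])
       (auto simp: uniform_measure_uniform_angle prob_space_uniform_angle intro!: PiM_cong)
qed

text \<open>Once the label of \<open>f\<close> is fixed, the other labels of \<open>F\<close> lie in the arc starting at it
  independently, each with probability \<open>\<tau>\<close>; the label of \<open>f\<close> itself contributes no factor.\<close>

lemma prob_arc_at_label_le:
  assumes F: "F \<subseteq> edges {1..n}" "f \<in> F" and \<tau>: "0 < \<tau>" "\<tau> < 1"
  shows "measure (null_law n) {X \<in> space (labellings n). \<forall>e\<in>F. X e \<in> angle_arc (X f) (2*pi*\<tau>)}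
    \<le> \<tau> ^ (card F - 1)"
proof -
  let ?U = "\<lambda>_::nat set. uniform_angle" and ?w = "2*pi*\<tau>"
  let ?G = "{X \<in> space (labellings n). \<forall>e\<in>F. X e \<in> angle_arc (X f) ?w}"
  define J where "J = edges {1..n} - {f}"
  have J: "finite J" "f \<notin> J" "edges {1..n} = insert f J" "F - {f} \<subseteq> J" "finite (F - {f})"
    using F finite_edges[of "{1..n}"] finite_subset[of F "edges {1..n}"] by (auto simp: J_def)
  interpret product_prob_space ?U J
    by (intro product_prob_space.intro product_sigma_finite.intro product_prob_space_axioms.intro
        prob_space_imp_sigma_finite prob_space_uniform_angle)
  interpret Q: prob_space "null_law n" by (rule prob_space_null_law)
  have G: "?G \<in> sets (null_law n)"
    unfolding sets_null_law pred_def[symmetric]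
    by (intro pred_intros_finite(3) pred_angle_arc measurable_label) (use F J in \<open>auto simp: finite_Diff2\<close>)
  have "emeasure (null_law n) ?G = (\<integral>\<^sup>+X. indicator ?G X \<partial>null_law n)" using G by simp
  also have "\<dots> = (\<integral>\<^sup>+y. \<integral>\<^sup>+x. indicator ?G (x(f := y)) \<partial>PiM J ?U \<partial>uniform_angle)"
    unfolding null_law_def J(3)
    by (rule product_nn_integral_insert_rev[OF J(1,2)])
       (use G[unfolded null_law_def J(3)] in simp)
  also have "\<dots> \<le> (\<integral>\<^sup>+y. ennreal (\<tau> ^ (card F - 1)) \<partial>uniform_angle)"
  proof (rule nn_integral_mono)
    fix y assume "y \<in> space uniform_angle"
    then have y: "y \<in> {0..<2*pi}" by simp
    let ?H = "{x \<in> space (PiM J ?U). \<forall>e\<in>F-{f}. x e \<in> angle_arc y ?w}"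
    have H: "emeasure (PiM J ?U) ?H = (\<Prod>e\<in>F-{f}. emeasure uniform_angle (angle_arc y ?w))"
      by (rule emeasure_PiM_Collect) (use J in auto)
    have "{x \<in> space (PiM J ?U). x e \<in> angle_arc y ?w} \<in> sets (PiM J ?U)" if "e \<in> F - {f}" for e
      using measurable_sets[OF measurable_component_singleton[of e J ?U], of "angle_arc y ?w"] that J(4)
      by (simp add: vimage_def Int_def conj_commute subset_iff)
    then have H_sets: "?H \<in> sets (PiM J ?U)"
      using J(5) by (intro sets.sets_Collect_finite_All) auto
    have "x(f := y) \<in> ?G \<Longrightarrow> x \<in> space (PiM J ?U) \<Longrightarrow> x \<in> ?H" for x
      by simp (metis DiffE singletonI)
    then have "(\<integral>\<^sup>+x. indicator ?G (x(f := y)) \<partial>PiM J ?U) \<le> (\<integral>\<^sup>+x. indicator ?H x \<partial>PiM J ?U)"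
      by (intro nn_integral_mono) (simp add: indicator_def del: fun_upd_apply)
    also have "\<dots> = ennreal (\<tau> ^ (card F - 1))"
      using H H_sets y \<tau> F J(5)
      by (simp add: uniform_angle.emeasure_eq_measure measure_uniform_angle_arc ennreal_power)
    finally show "(\<integral>\<^sup>+x. indicator ?G (x(f := y)) \<partial>PiM J ?U) \<le> ennreal (\<tau> ^ (card F - 1))" .
  qed
  also have "\<dots> = ennreal (\<tau> ^ (card F - 1))"
    by (simp add: uniform_angle.emeasure_space_1[simplified])
  finally show ?thesis
    using \<tau> by (simp add: Q.emeasure_eq_measure)
qed

section \<open>The planted law\<close>

locale hard_cluster =
  fixes n k :: nat and \<tau> :: real
  assumes k: "2 \<le> k" "k \<le> n" and \<tau>: "0 < \<tau>" "\<tau> < 1"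
begin

abbreviation Q where "Q \<equiv> null_law n"

sublocale Q: prob_space Q by (rule prob_space_null_law)

lemma communities_nonempty: "communities n k \<noteq> {}" "0 < card (communities n k)"
  using k card_communities[of n k] by (auto simp: zero_less_binomial_iff)

lemma edges_community_nonempty:
  assumes "C \<in> communities n k"
  shows "edges C \<noteq> {}"
proof -
  have "0 < card (edges C)" using communityD(6)[OF assms] k by (simp add: zero_less_binomial_iff)
  then show ?thesis by auto
qed

lemma test_eq:
  "community_interval_test n k \<tau> X =
    (if \<exists>C\<in>communities n k. \<exists>f\<in>edges C. \<forall>e\<in>edges C. X e \<in> angle_arc (X f) (2*pi*\<tau>) then 1 else 0)"
proof -
  have "(\<exists>\<theta>\<in>{0..<2*pi}. \<exists>C\<in>communities n k. \<forall>e\<in>edges C. X e \<in> angle_arc \<theta> (2*pi*\<tau>))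
    \<longleftrightarrow> (\<exists>C\<in>communities n k. \<exists>\<theta>\<in>{0..<2*pi}. \<forall>e\<in>edges C. X e \<in> angle_arc \<theta> (2*pi*\<tau>))"
    by blast
  also have "\<dots> \<longleftrightarrow> (\<exists>C\<in>communities n k. \<exists>f\<in>edges C. \<forall>e\<in>edges C. X e \<in> angle_arc (X f) (2*pi*\<tau>))"
    using \<tau> by (intro bex_cong refl some_arc_iff_arc_at_label communityD(5) edges_community_nonempty) auto
  finally show ?thesis by (simp add: community_interval_test_def)
qed

lemma test_in_tests: "community_interval_test n k \<tau> \<in> tests n"
proof -
  have "Measurable.pred (labellings n)
      (\<lambda>X. \<exists>C\<in>communities n k. \<exists>f\<in>edges C. \<forall>e\<in>edges C. X e \<in> angle_arc (X f) (2*pi*\<tau>))"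
    by (intro pred_intros_finite(4) pred_intros_finite(3) pred_angle_arc measurable_label
        finite_communities communityD(5)) (auto dest: subsetD[OF communityD(4)])
  then show ?thesis
    unfolding tests_def test_eq[abs_def] by (intro measurable_If measurable_const) (auto simp: pred_def)
qed

lemma prob_arc_event_community:
  assumes "C \<in> communities n k" "\<theta> \<in> {0..<2*pi}"
  shows "Q.prob (arc_event n \<tau> (edges C) \<theta>) = \<tau> ^ (k choose 2)"
  using prob_arc_event[OF communityD(5,4)[OF assms(1)] assms(2) \<tau>] communityD(6)[OF assms(1)] by simp

lemma
  assumes C: "C \<in> communities n k" and \<theta>: "\<theta> \<in> {0..<2*pi}"
  shows prob_space_conditional_law: "prob_space (conditional_law n \<tau> C \<theta>)"
    and sets_conditional_law: "sets (conditional_law n \<tau> C \<theta>) = sets (labellings n)"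
    and emeasure_conditional_law: "A \<in> sets (labellings n) \<Longrightarrow> emeasure (conditional_law n \<tau> C \<theta>) A
      = ennreal (Q.prob (A \<inter> arc_event n \<tau> (edges C) \<theta>) / \<tau> ^ (k choose 2))"
proof -
  let ?D = "arc_event n \<tau> (edges C) \<theta>"
  have D: "?D \<in> sets Q" using communityD[OF C] by simp
  have D_prob: "emeasure Q ?D = ennreal (\<tau> ^ (k choose 2))"
    by (simp add: Q.emeasure_eq_measure prob_arc_event_community[OF C \<theta>])
  note eq = conditional_law_eq[OF communityD(4)[OF C] \<theta> \<tau>]
  show "prob_space (conditional_law n \<tau> C \<theta>)"
    unfolding eq by (rule prob_space_uniform_measure) (use D_prob \<tau> in auto)
  show "sets (conditional_law n \<tau> C \<theta>) = sets (labellings n)" by (simp add: eq)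
  show "emeasure (conditional_law n \<tau> C \<theta>) A = ennreal (Q.prob (A \<inter> ?D) / \<tau> ^ (k choose 2))"
    if "A \<in> sets (labellings n)"
    using that D \<tau> emeasure_uniform_measure[OF D, of A]
    unfolding eq D_prob by (simp add: Q.emeasure_eq_measure divide_ennreal Int_commute)
qed

abbreviation parameter_law :: "(nat set \<times> real) measure" where
  "parameter_law \<equiv> uniform_count_measure (communities n k) \<Otimes>\<^sub>M uniform_angle"

lemma space_parameter_law: "space parameter_law = communities n k \<times> {0..<2*pi}"
  by (simp add: space_pair_measure space_uniform_count_measure)

lemma measurable_conditional_law:
  "(\<lambda>(C, \<theta>). conditional_law n \<tau> C \<theta>) \<in> parameter_law \<rightarrow>\<^sub>M subprob_algebra (labellings n)"
proof (rule measurable_subprob_algebra)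
  fix a assume "a \<in> space parameter_law"
  then obtain C \<theta> where a: "a = (C, \<theta>)" "C \<in> communities n k" "\<theta> \<in> {0..<2*pi}"
    by (auto simp: space_parameter_law)
  show "subprob_space (case a of (C, \<theta>) \<Rightarrow> conditional_law n \<tau> C \<theta>)"
    using prob_space_conditional_law[OF a(2,3)] a(1) by (simp add: prob_space_imp_subprob_space)
  show "sets (case a of (C, \<theta>) \<Rightarrow> conditional_law n \<tau> C \<theta>) = sets (labellings n)"
    using sets_conditional_law[OF a(2,3)] a(1) by simp
next
  fix A assume A: "A \<in> sets (labellings n)"
  have "(\<lambda>a. emeasure (case a of (C, \<theta>) \<Rightarrow> conditional_law n \<tau> C \<theta>) A)
      \<in> borel_measurable (count_space (communities n k) \<Otimes>\<^sub>M uniform_angle)"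
  proof (rule measurable_pair_measure_countable1)
    show "countable (communities n k)" using finite_communities by (rule countable_finite)
    fix C assume C: "C \<in> communities n k"
    let ?S = "{p \<in> space (uniform_angle \<Otimes>\<^sub>M Q). snd p \<in> A \<and> (\<forall>e\<in>edges C. snd p e \<in> angle_arc (fst p) (2*pi*\<tau>))}"
    have "?S \<in> sets (uniform_angle \<Otimes>\<^sub>M Q)"
      using pred_arc_event_jointly[OF communityD(5,4)[OF C]] A
      unfolding pred_def[symmetric] case_prod_beta
      by (intro pred_intros_logic(3) pred_sets2[OF _ measurable_snd]) auto
    then have "(\<lambda>\<theta>. emeasure Q (Pair \<theta> -` ?S) / ennreal (\<tau> ^ (k choose 2))) \<in> borel_measurable uniform_angle"
      by (intro borel_measurable_divide_ennreal Q.measurable_emeasure_Pair) auto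
    also have "?this \<longleftrightarrow> (\<lambda>\<theta>. emeasure (case (C, \<theta>) of (C, \<theta>) \<Rightarrow> conditional_law n \<tau> C \<theta>) A) \<in> borel_measurable uniform_angle"
    proof (rule measurable_cong)
      fix \<theta> assume "\<theta> \<in> space uniform_angle"
      then have \<theta>: "\<theta> \<in> {0..<2*pi}" by simp
      \<comment> \<open>The section of the joint event at \<open>\<theta>\<close> is the numerator of the conditional probability.\<close>
      have "Pair \<theta> -` ?S = A \<inter> arc_event n \<tau> (edges C) \<theta>"
        using \<theta> sets.sets_into_space[OF A] by (auto simp: arc_event_def space_pair_measure space_null_law)
      then show "emeasure Q (Pair \<theta> -` ?S) / ennreal (\<tau> ^ (k choose 2))
          = emeasure (case (C, \<theta>) of (C, \<theta>) \<Rightarrow> conditional_law n \<tau> C \<theta>) A"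
        using emeasure_conditional_law[OF C \<theta> A] \<tau> by (simp add: Q.emeasure_eq_measure divide_ennreal)
    qed
    finally show "(\<lambda>\<theta>. emeasure (case (C, \<theta>) of (C, \<theta>) \<Rightarrow> conditional_law n \<tau> C \<theta>) A) \<in> borel_measurable uniform_angle" .
  qed
  then show "(\<lambda>a. emeasure (case a of (C, \<theta>) \<Rightarrow> conditional_law n \<tau> C \<theta>) A) \<in> borel_measurable parameter_law"
    by (subst measurable_cong_sets[OF sets_pair_measure_cong[OF sets_uniform_count_measure_count_space refl] refl])
qed

lemma prob_space_parameter_law: "prob_space parameter_law"
  by (intro prob_space_pair prob_space_uniform_count_measure finite_communities communities_nonempty
      prob_space_uniform_angle)

lemma sets_planted_law: "sets (planted_law n k \<tau>) = sets (labellings n)"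
  unfolding planted_law_def
  by (rule sets_bind_measurable[OF measurable_conditional_law]) (simp add: prob_space.not_empty prob_space_parameter_law)

lemma space_planted_law: "space (planted_law n k \<tau>) = space (labellings n)"
  by (rule sets_eq_imp_space_eq) (rule sets_planted_law)

lemma subprob_space_planted_law: "subprob_space (planted_law n k \<tau>)"
  unfolding planted_law_def
  by (rule subprob_space_bind[OF prob_space_imp_subprob_space[OF prob_space_parameter_law] measurable_conditional_law])

text \<open>The phase is kept as the outer integral: for each fixed phase the inner mean over communities is a
  finite mixture of conditioned null laws.\<close>

lemma emeasure_planted_law:
  assumes A: "A \<in> sets (labellings n)"
  shows "emeasure (planted_law n k \<tau>) A =
    (\<integral>\<^sup>+\<theta>. ennreal ((\<Sum>C\<in>communities n k. Q.prob (A \<inter> arc_event n \<tau> (edges C) \<theta>))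
        / (real (card (communities n k)) * \<tau> ^ (k choose 2))) \<partial>uniform_angle)"
proof -
  let ?S = "communities n k" and ?K = "\<lambda>(C, \<theta>). conditional_law n \<tau> C \<theta>"
  interpret S: prob_space "uniform_count_measure ?S"
    by (intro prob_space_uniform_count_measure finite_communities communities_nonempty)
  interpret pair_prob_space "uniform_count_measure ?S" uniform_angle ..
  have "emeasure (planted_law n k \<tau>) A = (\<integral>\<^sup>+a. emeasure (?K a) A \<partial>parameter_law)"
    unfolding planted_law_def
    by (rule emeasure_bind[OF _ measurable_conditional_law A]) (rule not_empty)
  also have "\<dots> = (\<integral>\<^sup>+\<theta>. \<integral>\<^sup>+C. emeasure (?K (C, \<theta>)) A \<partial>uniform_count_measure ?S \<partial>uniform_angle)"
    by (rule nn_integral_snd[symmetric])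
       (rule measurable_emeasure_kernel[OF measurable_conditional_law A])
  also have "\<dots> = (\<integral>\<^sup>+\<theta>. ennreal ((\<Sum>C\<in>?S. Q.prob (A \<inter> arc_event n \<tau> (edges C) \<theta>))
        / (real (card ?S) * \<tau> ^ (k choose 2))) \<partial>uniform_angle)"
  proof (rule nn_integral_cong)
    fix \<theta> assume "\<theta> \<in> space uniform_angle"
    then have \<theta>: "\<theta> \<in> {0..<2*pi}" by simp
    have "(\<integral>\<^sup>+C. emeasure (?K (C, \<theta>)) A \<partial>uniform_count_measure ?S)
        = (\<Sum>C\<in>?S. ennreal (1 / card ?S) * emeasure (conditional_law n \<tau> C \<theta>) A)"
      by (simp add: nn_integral_uniform_count_measure[OF finite_communities])
    also have "\<dots> = (\<Sum>C\<in>?S. ennreal (Q.prob (A \<inter> arc_event n \<tau> (edges C) \<theta>) / (real (card ?S) * \<tau> ^ (k choose 2))))"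
      using \<tau> by (intro sum.cong refl) (simp add: emeasure_conditional_law[OF _ \<theta> A] flip: ennreal_mult')
    also have "\<dots> = ennreal (\<Sum>C\<in>?S. Q.prob (A \<inter> arc_event n \<tau> (edges C) \<theta>) / (real (card ?S) * \<tau> ^ (k choose 2)))"
      using \<tau> by (intro sum_ennreal) auto
    finally show "(\<integral>\<^sup>+C. emeasure (?K (C, \<theta>)) A \<partial>uniform_count_measure ?S)
        = ennreal ((\<Sum>C\<in>?S. Q.prob (A \<inter> arc_event n \<tau> (edges C) \<theta>)) / (real (card ?S) * \<tau> ^ (k choose 2)))"
      by (simp add: sum_divide_distrib)
  qed
  finally show ?thesis .
qed

section \<open>Achievability\<close>

text \<open>Under the planted law the true community and the true phase are witnesses for the test.\<close>

lemma p_miss_test: "p_miss n k \<tau> (community_interval_test n k \<tau>) = 0"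
proof -
  let ?A = "{X \<in> space (labellings n). community_interval_test n k \<tau> X = 0}"
  have A: "?A \<in> sets (labellings n)"
    using test_in_tests measurable_sets[of _ "labellings n" "count_space {0, 1}" "{0}"]
    by (simp add: tests_def vimage_def Int_def conj_commute)
  have "?A \<inter> arc_event n \<tau> (edges C) \<theta> = {}" if "C \<in> communities n k" "\<theta> \<in> {0..<2*pi}" for C \<theta>
  proof -
    have "community_interval_test n k \<tau> X = 1" if "X \<in> arc_event n \<tau> (edges C) \<theta>" for X
      using that \<open>C \<in> communities n k\<close> \<open>\<theta> \<in> {0..<2*pi}\<close>
      unfolding community_interval_test_def arc_event_def by (intro if_P) blast
    then show ?thesis by force
  qed
  then have "emeasure (planted_law n k \<tau>) ?A = (\<integral>\<^sup>+\<theta>. 0 \<partial>uniform_angle)"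
    unfolding emeasure_planted_law[OF A] by (intro nn_integral_cong) simp
  then show ?thesis by (simp add: p_miss_def space_planted_law measure_def)
qed

lemma fa_bound_eq:
  "fa_bound n k \<tau> = (exp 1 * real n / real k) ^ k * (real (k choose 2) * \<tau> ^ ((k choose 2) - 1))"
proof -
  let ?M = "k choose 2"
  have M: "0 < ?M" using k by (simp add: zero_less_binomial_iff)
  have "fa_bound n k \<tau> = exp (ln (real ?M / \<tau>)) * exp (real k * (ln (exp 1 * real n / real k)))
      * exp (real ?M * ln \<tau>)"
    using k by (simp add: fa_bound_def real_choose_two ln_mult ln_div algebra_simps flip: exp_add)
  also have "\<dots> = real ?M / \<tau> * (exp 1 * real n / real k) ^ k * \<tau> ^ ?M"
    using k \<tau> M by (simp add: exp_of_nat_mult)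
  also have "\<tau> ^ ?M = \<tau> * \<tau> ^ (?M - 1)"
    using M by (cases ?M) auto
  finally show ?thesis using \<tau> by simp
qed

text \<open>A union bound over the \<open>n choose k\<close> sets \<open>C\<close> and the \<open>k choose 2\<close> edges of each whose label may come
  first on the arc.\<close>

lemma p_fa_test: "p_fa n (community_interval_test n k \<tau>) \<le> fa_bound n k \<tau>"
proof -
  let ?M = "k choose 2" and ?S = "communities n k"
  define G where "G C f = {X \<in> space (labellings n). \<forall>e\<in>edges C. X e \<in> angle_arc (X f) (2*pi*\<tau>)}" for C f
  have G: "G C f \<in> sets Q" if "C \<in> ?S" "f \<in> edges C" for C f
    unfolding G_def sets_null_law pred_def[symmetric]
    by (intro pred_intros_finite(3) pred_angle_arc measurable_label communityD(5)[OF that(1)])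
       (use that communityD(4) in auto)
  have "p_fa n (community_interval_test n k \<tau>) = Q.prob (\<Union>C\<in>?S. \<Union>f\<in>edges C. G C f)"
    unfolding p_fa_def by (intro arg_cong[where f=Q.prob]) (auto simp: space_null_law test_eq G_def split: if_splits)
  also have "\<dots> \<le> (\<Sum>C\<in>?S. Q.prob (\<Union>f\<in>edges C. G C f))"
    by (intro measure_UNION_le finite_communities sets.finite_UN communityD(5) G)
  also have "\<dots> \<le> (\<Sum>C\<in>?S. \<Sum>f\<in>edges C. Q.prob (G C f))"
    by (intro sum_mono measure_UNION_le communityD(5) G)
  also have "\<dots> \<le> (\<Sum>C\<in>?S. \<Sum>f\<in>edges C. \<tau> ^ (?M - 1))"
  proof (intro sum_mono)
    fix C f assume C: "C \<in> ?S" and f: "f \<in> edges C"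
    show "Q.prob (G C f) \<le> \<tau> ^ (?M - 1)"
      using prob_arc_at_label_le[OF communityD(4)[OF C] f \<tau>] communityD(6)[OF C] by (simp add: G_def)
  qed
  also have "\<dots> = real (n choose k) * (real ?M * \<tau> ^ (?M - 1))"
    by (simp add: communityD(6) card_communities)
  also have "\<dots> \<le> (exp 1 * real n / real k) ^ k * (real ?M * \<tau> ^ (?M - 1))"
    using k \<tau> by (intro mult_right_mono binomial_le_exp_power) auto
  finally show ?thesis by (simp add: fa_bound_eq)
qed

section \<open>Converse\<close>

text \<open>The factor by which each vertex shared by two communities multiplies the bound on the overlap
  probability. Two communities that share \<open>j \<le> k\<close> vertices share \<open>j * (j - 1) / 2 \<le> j * (k - 1) / 2\<close> edges,
  and each shared edge gains a factor \<open>1 / \<tau>\<close>; charging \<open>(k - 1) / 2\<close> edges to each vertex makes the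
  exponent linear in \<open>j\<close>, so that the mean gain is bounded by the generating function of \<open>j\<close>.\<close>

definition overlap_weight :: real where
  "overlap_weight = (1 / \<tau>) powr ((real k - 1) / 2)"

lemma overlap_weight_ge_1: "1 \<le> overlap_weight"
  unfolding overlap_weight_def using k \<tau> by (intro ge_one_powr_ge_zero) auto

text \<open>For the same phase both events ask for the same arc, so the \<open>j choose 2\<close> edges common to both
  communities contribute their factor \<open>\<tau>\<close> only once, where \<open>j = card (C \<inter> C')\<close>.\<close>

lemma prob_arc_event_overlap_le:
  assumes C: "C \<in> communities n k" "C' \<in> communities n k" and \<theta>: "\<theta> \<in> {0..<2*pi}"
  shows "Q.prob (arc_event n \<tau> (edges C) \<theta> \<inter> arc_event n \<tau> (edges C') \<theta>)
    \<le> (\<tau> ^ (k choose 2))\<^sup>2 * overlap_weight ^ card (C \<inter> C')"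
proof -
  let ?E = "edges C" and ?E' = "edges C'" and ?M = "k choose 2" and ?j = "card (C \<inter> C')"
  note [simp] = communityD(5)[OF C(1)] communityD(5)[OF C(2)]
  have j: "?j \<le> k" using communityD(1,3)[OF C(1)] card_mono[of C "C \<inter> C'"] by auto
  have "card (?E \<inter> ?E') = ?j choose 2"
    using communityD(1)[OF C(1)] by (simp add: edges_Int card_edges)
  moreover have "card (?E \<union> ?E') + card (?E \<inter> ?E') = ?M + ?M"
    using card_Un_Int[of ?E ?E'] communityD(6)[OF C(1)] communityD(6)[OF C(2)] by simp
  ultimately have card: "card (?E \<union> ?E') + (?j choose 2) = ?M + ?M" by simp
  have "(real ?j - 1) * real ?j \<le> (real k - 1) * real ?j"
    using j by (intro mult_right_mono) auto
  then have "real (?j choose 2) \<le> (real k - 1) / 2 * real ?j"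
    by (simp add: real_choose_two mult.commute)
  then have "(1 / \<tau>) powr real (?j choose 2) \<le> (1 / \<tau>) powr ((real k - 1) / 2 * real ?j)"
    using \<tau> by (intro powr_mono) auto
  also have "\<dots> = overlap_weight ^ ?j"
    unfolding overlap_weight_def using \<tau> by (subst powr_powr[symmetric], subst powr_realpow) auto
  finally have pow: "(1 / \<tau>) ^ (?j choose 2) \<le> overlap_weight ^ ?j"
    using \<tau> by (simp add: powr_realpow)
  have "arc_event n \<tau> ?E \<theta> \<inter> arc_event n \<tau> ?E' \<theta> = arc_event n \<tau> (?E \<union> ?E') \<theta>"
    by (auto simp: arc_event_def)
  then have "Q.prob (arc_event n \<tau> ?E \<theta> \<inter> arc_event n \<tau> ?E' \<theta>) = \<tau> ^ card (?E \<union> ?E')"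
    using communityD(4)[OF C(1)] communityD(4)[OF C(2)] prob_arc_event[of "?E \<union> ?E'" n \<theta> \<tau>] \<theta> \<tau>
    by simp
  also have "\<dots> = \<tau> ^ (card (?E \<union> ?E') + (?j choose 2)) * (1 / \<tau>) ^ (?j choose 2)"
    using \<tau> by (simp add: power_add power_one_over)
  also have "\<dots> = (\<tau> ^ ?M)\<^sup>2 * (1 / \<tau>) ^ (?j choose 2)"
    by (simp add: card power_add power2_eq_square)
  also have "\<dots> \<le> (\<tau> ^ ?M)\<^sup>2 * overlap_weight ^ ?j"
    using pow by (intro mult_left_mono) auto
  finally show ?thesis .
qed

text \<open>For two independent uniform communities the overlap is hypergeometric, so the mean of
  \<open>overlap_weight ^ card (C \<inter> C')\<close> is at most
  \<open>(1 + k / n * (overlap_weight - 1)) ^ k\<close>, and \<open>1 + x \<le> exp x\<close>.\<close>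

lemma overlap_second_moment_le:
  assumes \<theta>: "\<theta> \<in> {0..<2*pi}"
  shows "(\<Sum>C\<in>communities n k. \<Sum>C'\<in>communities n k.
        Q.prob (arc_event n \<tau> (edges C) \<theta> \<inter> arc_event n \<tau> (edges C') \<theta>))
      / (real (card (communities n k)) * \<tau> ^ (k choose 2))\<^sup>2
    \<le> exp (real k ^ 2 / real n * (overlap_weight - 1))"
proof -
  let ?S = "communities n k" and ?N = "real (card (communities n k))" and ?t = "(\<tau> ^ (k choose 2))\<^sup>2"
  let ?B = "exp (real k ^ 2 / real n * (overlap_weight - 1))" and ?b = "real k / real n * (overlap_weight - 1)"
  have "(1 + ?b) ^ k \<le> exp ?b ^ k"
    using overlap_weight_ge_1 exp_ge_add_one_self[of ?b] by (intro power_mono) auto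
  also have "\<dots> = ?B"
    by (simp add: power2_eq_square mult.assoc flip: exp_of_nat_mult)
  finally have mgf: "(1 + ?b) ^ k \<le> ?B" .
  have "(\<Sum>C'\<in>?S. overlap_weight ^ card (C \<inter> C')) \<le> ?N * ?B" if "C \<in> ?S" for C
  proof -
    have "(\<Sum>C'\<in>?S. overlap_weight ^ card (C \<inter> C')) \<le> ?N * (1 + ?b) ^ k"
      using hypergeometric_power_mean_le[of "{1..n}" C k overlap_weight, folded communities_def]
        communityD[OF that] overlap_weight_ge_1
      by (simp add: card_communities)
    also have "\<dots> \<le> ?N * ?B" using mgf by (intro mult_left_mono) auto
    finally show ?thesis .
  qed
  then have "(\<Sum>C\<in>?S. \<Sum>C'\<in>?S. overlap_weight ^ card (C \<inter> C')) \<le> ?N * (?N * ?B)"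
    by (rule sum_bounded_above)
  then have "?t * (\<Sum>C\<in>?S. \<Sum>C'\<in>?S. overlap_weight ^ card (C \<inter> C')) \<le> ?t * (?N * (?N * ?B))"
    by (rule mult_left_mono) simp
  moreover have "(\<Sum>C\<in>?S. \<Sum>C'\<in>?S. Q.prob (arc_event n \<tau> (edges C) \<theta> \<inter> arc_event n \<tau> (edges C') \<theta>))
      \<le> ?t * (\<Sum>C\<in>?S. \<Sum>C'\<in>?S. overlap_weight ^ card (C \<inter> C'))"
    unfolding sum_distrib_left by (intro sum_mono prob_arc_event_overlap_le \<theta>)
  ultimately have "(\<Sum>C\<in>?S. \<Sum>C'\<in>?S. Q.prob (arc_event n \<tau> (edges C) \<theta> \<inter> arc_event n \<tau> (edges C') \<theta>))
      \<le> ?B * (?N * \<tau> ^ (k choose 2))\<^sup>2"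
    by (simp add: power2_eq_square mult_ac)
  moreover have "0 < (?N * \<tau> ^ (k choose 2))\<^sup>2"
    using communities_nonempty \<tau> by (intro zero_less_power mult_pos_pos) auto
  ultimately show ?thesis by (simp add: pos_divide_le_eq)
qed

text \<open>The second moment bound does not depend on the phase. It can therefore be applied to the mixture
  over communities at each phase separately and then integrated over the phase.\<close>

lemma error_sum_ge:
  assumes \<phi>: "\<phi> \<in> tests n"
  shows "1 - sqrt (exp (real k ^ 2 / real n * (overlap_weight - 1)) - 1) \<le> p_fa n \<phi> + p_miss n k \<tau> \<phi>"
proof -
  let ?A = "{X \<in> space (labellings n). \<phi> X = 0}" and ?B = "{X \<in> space (labellings n). \<phi> X = 1}"
  let ?S = "communities n k"
  define \<delta> where "\<delta> = sqrt (exp (real k ^ 2 / real n * (overlap_weight - 1)) - 1)"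
  interpret P: subprob_space "planted_law n k \<tau>" by (rule subprob_space_planted_law)
  have meas: "\<phi> \<in> labellings n \<rightarrow>\<^sub>M count_space {0, 1}" using \<phi> by (simp add: tests_def)
  have A: "?A \<in> sets (labellings n)"
    using measurable_sets[OF meas, of "{0}"] by (simp add: vimage_def Int_def conj_commute)
  have "\<phi> X = 1 \<longleftrightarrow> \<phi> X \<noteq> 0" if "X \<in> space (labellings n)" for X
    using measurable_space[OF meas that] by auto
  then have "?B = {X \<in> space (labellings n). \<phi> X \<noteq> 0}" by (intro Collect_cong conj_cong refl)
  also have "\<dots> = space Q - ?A" by (auto simp: space_null_law)
  finally have "?B = space Q - ?A" .
  then have fa: "p_fa n \<phi> = 1 - Q.prob ?A"
    using A by (simp add: p_fa_def space_null_law[symmetric] Q.prob_compl)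
  have "ennreal (Q.prob ?A - \<delta>) = (\<integral>\<^sup>+\<theta>. ennreal (Q.prob ?A - \<delta>) \<partial>uniform_angle)"
    using uniform_angle.emeasure_space_1 by simp
  also have "\<dots> \<le> emeasure (planted_law n k \<tau>) ?A"
    unfolding emeasure_planted_law[OF A]
  proof (intro nn_integral_mono ennreal_leI)
    fix \<theta> assume "\<theta> \<in> space uniform_angle"
    then have \<theta>: "\<theta> \<in> {0..<2*pi}" by simp
    have D: "arc_event n \<tau> (edges C) \<theta> \<in> sets Q" if "C \<in> ?S" for C
      using communityD[OF that] by simp
    show "Q.prob ?A - \<delta> \<le> (\<Sum>C\<in>?S. Q.prob (?A \<inter> arc_event n \<tau> (edges C) \<theta>))
        / (real (card ?S) * \<tau> ^ (k choose 2))"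
      unfolding \<delta>_def
      by (rule Q.mixture_second_moment_bound)
         (use A D \<tau> \<theta> finite_communities communities_nonempty overlap_second_moment_le[OF \<theta>]
          in \<open>auto simp: prob_arc_event_community\<close>)
  qed
  finally have "ennreal (Q.prob ?A - \<delta>) \<le> ennreal (measure (planted_law n k \<tau>) ?A)"
    by (simp add: P.emeasure_eq_measure)
  then have "Q.prob ?A - \<delta> \<le> p_miss n k \<tau> \<phi>"
    by (simp add: p_miss_def space_planted_law)
  then show ?thesis using fa by (simp add: \<delta>_def)
qed

end

section \<open>Strong detection and its impossibility\<close>

theorem theorem3:
  fixes k :: "nat \<Rightarrow> nat" and \<tau> :: "nat \<Rightarrow> real"
  assumes k: "\<forall>n\<ge>2. 2 \<le> k n \<and> k n \<le> n"
    and \<tau>: "\<forall>n\<ge>2. 0 < \<tau> n \<and> \<tau> n < 1"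
  shows "(\<forall>n\<ge>2. community_interval_test n (k n) (\<tau> n) \<in> tests n \<and>
            p_miss n (k n) (\<tau> n) (community_interval_test n (k n) (\<tau> n)) = 0 \<and>
            p_fa n (community_interval_test n (k n) (\<tau> n)) \<le> fa_bound n (k n) (\<tau> n)) \<and>
         ((\<lambda>n. fa_bound n (k n) (\<tau> n)) \<longlonglongrightarrow> 0 \<longrightarrow>
            achieves_strong_detection k \<tau> (\<lambda>n. community_interval_test n (k n) (\<tau> n))) \<and>
         ((\<lambda>n. real (k n)^2 / real n * ((1 / \<tau> n) powr ((real (k n) - 1) / 2) - 1)) \<longlonglongrightarrow> 0 \<longrightarrow>
            weak_detection_impossible k \<tau>)"
proof -
  let ?\<phi> = "\<lambda>n. community_interval_test n (k n) (\<tau> n)"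
  have model: "hard_cluster n (k n) (\<tau> n)" if "2 \<le> n" for n
    using that k \<tau> by (simp add: hard_cluster_def)
  have test: "?\<phi> n \<in> tests n" "p_miss n (k n) (\<tau> n) (?\<phi> n) = 0" "p_fa n (?\<phi> n) \<le> fa_bound n (k n) (\<tau> n)"
    if "2 \<le> n" for n
    using model[OF that] by (simp_all add: hard_cluster.test_in_tests hard_cluster.p_miss_test hard_cluster.p_fa_test)
  have "achieves_strong_detection k \<tau> ?\<phi>" if bound: "(\<lambda>n. fa_bound n (k n) (\<tau> n)) \<longlonglongrightarrow> 0"
  proof -
    have "(\<lambda>n. p_fa n (?\<phi> n)) \<longlonglongrightarrow> 0"
    proof (rule tendsto_sandwich[OF _ _ tendsto_const bound])
      show "\<forall>\<^sub>F n in sequentially. 0 \<le> p_fa n (?\<phi> n)" by (simp add: p_fa_def)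
      show "\<forall>\<^sub>F n in sequentially. p_fa n (?\<phi> n) \<le> fa_bound n (k n) (\<tau> n)"
        using test(3) by (auto simp: eventually_sequentially)
    qed
    moreover have "(\<lambda>n. p_miss n (k n) (\<tau> n) (?\<phi> n)) \<longlonglongrightarrow> 0"
      by (rule tendsto_eventually) (use test(2) in \<open>auto simp: eventually_sequentially\<close>)
    ultimately show ?thesis
      using test(1) by (simp add: achieves_strong_detection_def test_sequence_def)
  qed
  moreover have "weak_detection_impossible k \<tau>"
    if small: "(\<lambda>n. real (k n)^2 / real n * ((1 / \<tau> n) powr ((real (k n) - 1) / 2) - 1)) \<longlonglongrightarrow> 0"
  proof -
    define \<epsilon> where
      "\<epsilon> n = sqrt (exp (real (k n)^2 / real n * ((1 / \<tau> n) powr ((real (k n) - 1) / 2) - 1)) - 1)" for n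
    have "\<epsilon> \<longlonglongrightarrow> sqrt (exp 0 - 1)"
      unfolding \<epsilon>_def by (intro tendsto_intros small)
    moreover have "1 - \<epsilon> n \<le> p_fa n (\<phi> n) + p_miss n (k n) (\<tau> n) (\<phi> n)"
      if "test_sequence \<phi>" "2 \<le> n" for \<phi> n
      using hard_cluster.error_sum_ge[OF model[OF that(2)], of "\<phi> n"] that
      by (simp add: \<epsilon>_def test_sequence_def hard_cluster.overlap_weight_def[OF model])
    ultimately show ?thesis
      unfolding weak_detection_impossible_def by (intro allI impI exI[of _ \<epsilon>]) simp
  qed
  ultimately show ?thesis using test by simp
qed

end
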